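(* Assume that $\mathbb{P}(\lim_{|k|\to\infty}|\boldsymbol Y_k|=0)=1$. Let $H$ be a shift invariant, non negative measurable function on $(\mathbb{R}^d)^{\mathbb{Z}}$. Then $$\vartheta\,\mathbb{E}[H(\boldsymbol Q)]=\mathbb{E}\left[H(\boldsymbol\Theta)\mathbf{1}\{I(\boldsymbol\Theta)=0\}\right].$$
   Context: Let $|\cdot|$ be an arbitrary norm on $\mathbb{R}^d$. Let $\{\boldsymbol X_j,j\in\mathbb{Z}\}$ be a stationary $\mathbb{R}^d$-valued time series which is regularly varying: for all integers $s\le t$ there is a non-zero Radon measure $\nu_{s,t}$ on $(\mathbb{R}^d)^{[s,t]}\setminus\{\boldsymbol 0\}$ such that $\mathbb{P}(u^{-1}(\boldsymbol X_s,\dots,\boldsymbol X_t)\in\cdot)/\mathbb{P}(|\boldsymbol X_0|>u)\to\nu_{s,t}$ vaguely as $u\to\infty$. Let $\alpha>0$ be its tail index. The tail process is the random sequence $\boldsymbol Y=\{\boldsymbol Y_j,j\in\mathbb{Z}\}$ with $\mathbb{P}(|\boldsymbol Y_0|>y)=y^{-\alpha}$ for $y\ge1$ and such that, for all $s\le t$, the law of $u^{-1}(\boldsymbol X_s,\dots,\boldsymbol X_t)$ conditionally on $|\boldsymbol X_0|>u$ converges weakly to that of $(\boldsymbol Y_s,\dots,\boldsymbol Y_t)$ as $u\to\infty$. The spectral tail process is $\boldsymbol\Theta_j=\boldsymbol Y_j/|\boldsymbol Y_0|$, $j\in\mathbb{Z}$; it is independent of $|\boldsymbol Y_0|$. The tail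 measure $\nu$ is the unique Borel measure on $(\mathbb{R}^d)^{\mathbb{Z}}$ (product topology) with $\nu(\{\boldsymbol 0\})=0$ and $\nu\circ p_{s,t}^{-1}=\nu_{s,t}$ on $(\mathbb{R}^d)^{[s,t]}\setminus\{\boldsymbol 0\}$ for all $s\le t$, where $p_{s,t}$ is the canonical projection. It is known that $\nu$ is $\sigma$-finite, shift invariant, satisfies $\nu(c\,\cdot)=c^{-\alpha}\nu$ for all $c>0$, and $\mathbb{E}[H(\boldsymbol Y)]=\int H(\boldsymbol y)\mathbf{1}\{|\boldsymbol y_0|>1\}\,\nu(\mathrm{d}\boldsymbol y)$ for every non negative measurable $H$. Notation: $B$ is the backshift, $(B\boldsymbol x)_j=\boldsymbol x_{j-1}$; $H$ is shift invariant if $H(B\boldsymbol x)=H(\boldsymbol x)$ for all $\boldsymbol x$. For $-\infty\le s\le t\le\infty$, $\boldsymbol y^*_{s,t}=\max_{s\le i\le t}|\boldsymbol y_i|$ and $\boldsymbol y^*=\max_{i\in\mathbb{Z}}|\boldsymbol y_i|$ (understood as suprema in $[0,\infty]$). The infargmax functional $I$ is: $I(\boldsymbol y)=j\in\mathbb{Z}$ if $\boldsymbol y^*_{-\infty,j-1}<|\boldsymbol y_j|$ and $\boldsymbol y^*_{j+1,\infty}\le|\boldsymbol y_j|$; $I(\boldsymbol y)=-\infty$ if $\boldsymbol y^*=\boldsymbol y^*_{-\infty,j}$ for all $j$; $I(\boldsymbol y)=+\infty$ if $\boldsymbol y^*>\boldsymbol y^*_{-\infty,j}$ for all $j$. The candidate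 extremal index is $\vartheta=\mathbb{P}(\sup_{j\ge1}|\boldsymbol Y_j|\le1)$, which also equals $\mathbb{P}(\sup_{j\le-1}|\boldsymbol Y_j|\le1)$; when $\mathbb{P}(\lim_{|k|\to\infty}|\boldsymbol Y_k|=0)=1$, one has $\vartheta>0$. In that case $\boldsymbol Q=\{\boldsymbol Q_j,j\in\mathbb{Z}\}$ denotes a random sequence whose distribution is that of $(\boldsymbol Y^* )^{-1}\boldsymbol Y$ conditionally on $\boldsymbol Y^*_{-\infty,-1}\le1$. *)

theory Defs
  imports "HOL-Probability.Probability" "HOL-Library.Extended"
begin

section \<open>Norms, path spaces and functionals of paths\<close>

text \<open>An arbitrary norm on the vector space, not necessarily the Euclidean norm of the type class.
  Nonnegativity follows from the three clauses.\<close>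

definition is_norm :: "('a::real_vector \<Rightarrow> real) \<Rightarrow> bool" where
  "is_norm N \<longleftrightarrow>
     (\<forall>x. N x = 0 \<longleftrightarrow> x = 0) \<and>
     (\<forall>c x. N (c *\<^sub>R x) = \<bar>c\<bar> * N x) \<and>
     (\<forall>x y. N (x + y) \<le> N x + N y)"

text \<open>Paths indexed by the integers are functions on \<^typ>\<open>int\<close>; their measurable structure is \<^const>\<open>borel\<close>
  of the product topology (the topology of the function type), which by the library fact \<open>sets_PiM_equal_borel\<close>
  is the product sigma-algebra.\<close>

definition backshift :: "(int \<Rightarrow> 'a) \<Rightarrow> int \<Rightarrow> 'a" where
  "backshift x = (\<lambda>j. x (j - 1))"

definition shift_invariant :: "((int \<Rightarrow> 'a) \<Rightarrow> 'b) \<Rightarrow> bool" where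
  "shift_invariant H \<longleftrightarrow> (\<forall>x. H (backshift x) = H x)"

text \<open>The supremum in $[0,\infty]$ of the norms over a set of indices; it is 0 on the empty set.\<close>

definition path_sup :: "('a \<Rightarrow> real) \<Rightarrow> int set \<Rightarrow> (int \<Rightarrow> 'a) \<Rightarrow> ennreal" where
  "path_sup N A y = (SUP i\<in>A. ennreal (N (y i)))"

definition is_infargmax :: "('a \<Rightarrow> real) \<Rightarrow> (int \<Rightarrow> 'a) \<Rightarrow> int \<Rightarrow> bool" where
  "is_infargmax N y j \<longleftrightarrow>
     path_sup N {..j - 1} y < ennreal (N (y j)) \<and> path_sup N {j + 1..} y \<le> ennreal (N (y j))"

definition infargmax :: "('a \<Rightarrow> real) \<Rightarrow> (int \<Rightarrow> 'a) \<Rightarrow> int extended" where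
  "infargmax N y =
     (if \<exists>j. is_infargmax N y j then Fin (THE j. is_infargmax N y j)
      else if \<forall>j. path_sup N UNIV y = path_sup N {..j} y then Minf
      else Pinf)"

text \<open>The three clauses that characterize the infargmax functional; in particular they are exhaustive
  and mutually exclusive.\<close>

lemma path_sup_mono: "A \<subseteq> B \<Longrightarrow> path_sup N A y \<le> path_sup N B y"
  unfolding path_sup_def by (rule SUP_subset_mono) auto

lemma path_sup_upper: "i \<in> A \<Longrightarrow> ennreal (N (y i)) \<le> path_sup N A y"
  unfolding path_sup_def by (rule SUP_upper)

lemma path_sup_Un: "path_sup N (A \<union> B) y = max (path_sup N A y) (path_sup N B y)"
  unfolding path_sup_def by (simp add: SUP_union sup_max)

lemma is_infargmax_not_less:
  assumes "is_infargmax N y i" "is_infargmax N y j" shows "\<not> i < j"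
proof
  assume "i < j"
  have "ennreal (N (y i)) \<le> path_sup N {..j - 1} y"
    by (rule path_sup_upper) (use \<open>i < j\<close> in auto)
  also have "\<dots> < ennreal (N (y j))" using assms(2) by (simp add: is_infargmax_def)
  also have "\<dots> \<le> path_sup N {i + 1..} y"
    by (rule path_sup_upper) (use \<open>i < j\<close> in auto)
  also have "\<dots> \<le> ennreal (N (y i))" using assms(1) by (simp add: is_infargmax_def)
  finally show False by simp
qed

lemma is_infargmax_unique:
  assumes "is_infargmax N y i" "is_infargmax N y j" shows "i = j"
  using is_infargmax_not_less[OF assms] is_infargmax_not_less[OF assms(2,1)] by simp

lemma path_sup_infargmax:
  assumes "is_infargmax N y j"
  shows "path_sup N UNIV y = path_sup N {..j} y" and "path_sup N {..j - 1} y < path_sup N UNIV y"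
proof -
  have j: "ennreal (N (y j)) \<le> path_sup N {..j} y" by (rule path_sup_upper) simp
  have "(UNIV :: int set) = {..j} \<union> {j + 1..}" by auto
  then have "path_sup N UNIV y = max (path_sup N {..j} y) (path_sup N {j + 1..} y)"
    using path_sup_Un[of N "{..j}" "{j + 1..}" y] by (simp only:)
  then show eq: "path_sup N UNIV y = path_sup N {..j} y"
    using j assms by (auto simp: is_infargmax_def max_def)
  show "path_sup N {..j - 1} y < path_sup N UNIV y"
    using j assms unfolding eq by (auto simp: is_infargmax_def)
qed

lemma infargmax_exists:
  assumes "path_sup N UNIV y = path_sup N {..k} y" and "path_sup N UNIV y \<noteq> path_sup N {..l} y"
  shows "\<exists>j. is_infargmax N y j"
proof -
  define S where "S = {j. path_sup N UNIV y = path_sup N {..j} y}"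
  have low: "l < j" if "j \<in> S" for j
  proof (rule ccontr)
    assume "\<not> l < j"
    then have "path_sup N {..j} y \<le> path_sup N {..l} y" by (intro path_sup_mono) auto
    moreover have "path_sup N {..l} y \<le> path_sup N UNIV y" by (intro path_sup_mono) auto
    ultimately show False using that assms(2) by (simp add: S_def)
  qed
  have "\<exists>j. j \<in> S \<and> (\<forall>i. i \<in> S \<longrightarrow> nat (j - l) \<le> nat (i - l))"
    using ex_has_least_nat[of "\<lambda>j. j \<in> S" k "\<lambda>j. nat (j - l)"] assms(1)
    by (auto simp: S_def)
  then obtain j where j: "j \<in> S" "\<And>i. i \<in> S \<Longrightarrow> nat (j - l) \<le> nat (i - l)" by blast
  have "j - 1 \<notin> S" using j(2)[of "j - 1"] low[OF j(1)] by auto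
  moreover have "path_sup N {..j - 1} y \<le> path_sup N UNIV y" by (intro path_sup_mono) auto
  ultimately have less: "path_sup N {..j - 1} y < path_sup N UNIV y" by (auto simp: S_def)
  have "{..j} = {..j - 1} \<union> {j}" by auto
  then have "path_sup N {..j} y = max (path_sup N {..j - 1} y) (path_sup N {j} y)"
    using path_sup_Un[of N "{..j - 1}" "{j}" y] by (simp only:)
  then have "path_sup N UNIV y = ennreal (N (y j))"
    using j(1) less by (auto simp: S_def path_sup_def max_def split: if_splits)
  moreover have "path_sup N {j + 1..} y \<le> path_sup N UNIV y" by (intro path_sup_mono) auto
  ultimately show ?thesis using less by (auto simp: is_infargmax_def)
qed

lemma infargmax_eq_Fin_iff: "infargmax N y = Fin j \<longleftrightarrow> is_infargmax N y j"
proof -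
  have "(THE i. is_infargmax N y i) = k" if "is_infargmax N y k" for k
    using that is_infargmax_unique by blast
  then show ?thesis unfolding infargmax_def by (auto split: if_splits)
qed

lemma infargmax_eq_Minf_iff:
  "infargmax N y = Minf \<longleftrightarrow> (\<forall>j. path_sup N UNIV y = path_sup N {..j} y)"
  unfolding infargmax_def using path_sup_infargmax(2) by (metis extended.distinct less_irrefl)

lemma infargmax_eq_Pinf_iff:
  "infargmax N y = Pinf \<longleftrightarrow> (\<forall>j. path_sup N {..j} y < path_sup N UNIV y)"
proof
  assume "infargmax N y = Pinf"
  then have "\<not> (\<exists>j. is_infargmax N y j)" "\<not> (\<forall>j. path_sup N UNIV y = path_sup N {..j} y)"
    unfolding infargmax_def by (auto split: if_splits)
  then have "path_sup N UNIV y \<noteq> path_sup N {..j} y" for j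
    using infargmax_exists by blast
  moreover have "path_sup N {..j} y \<le> path_sup N UNIV y" for j by (intro path_sup_mono) auto
  ultimately show "\<forall>j. path_sup N {..j} y < path_sup N UNIV y" by (metis order_le_less)
next
  assume less: "\<forall>j. path_sup N {..j} y < path_sup N UNIV y"
  then have "\<not> (\<exists>j. is_infargmax N y j)" using path_sup_infargmax(1) by (metis less_irrefl)
  with less show "infargmax N y = Pinf" unfolding infargmax_def by (metis less_irrefl)
qed

section \<open>Finite-dimensional spaces and modes of convergence\<close>

text \<open>The space of vectors indexed by the integer interval from s to t consists of the functions
  extensional on that interval, the carrier of both the product topology and the product
  sigma-algebra.\<close>

definition window_top :: "int \<Rightarrow> int \<Rightarrow> (int \<Rightarrow> 'a::topological_space) topology" where
  "window_top s t = product_topology (\<lambda>_. euclidean) {s..t}"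

definition window_borel :: "int \<Rightarrow> int \<Rightarrow> (int \<Rightarrow> 'a::topological_space) measure" where
  "window_borel s t = PiM {s..t} (\<lambda>_. borel)"

definition window_zero :: "int \<Rightarrow> int \<Rightarrow> int \<Rightarrow> 'a::zero" where
  "window_zero s t = restrict (\<lambda>_. 0) {s..t}"

definition punctured_top :: "int \<Rightarrow> int \<Rightarrow> (int \<Rightarrow> 'a::{topological_space,zero}) topology" where
  "punctured_top s t = subtopology (window_top s t) (- {window_zero s t})"

text \<open>On the locally compact, second countable spaces considered here, a Borel measure that is
  finite on compact sets is automatically inner and outer regular.\<close>

definition radon_on :: "'a topology \<Rightarrow> 'a measure \<Rightarrow> bool" where
  "radon_on T \<nu> \<longleftrightarrow>
     space \<nu> = topspace T \<and>
     sets \<nu> = sigma_sets (topspace T) {U. openin T U} \<and>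
     (\<forall>K. compactin T K \<longrightarrow> emeasure \<nu> K < \<infinity>)"

definition vague_conv_at_top :: "'a topology \<Rightarrow> (real \<Rightarrow> 'a measure) \<Rightarrow> 'a measure \<Rightarrow> bool" where
  "vague_conv_at_top T \<mu> \<nu> \<longleftrightarrow>
     (\<forall>f :: 'a \<Rightarrow> real.
        continuous_map T euclideanreal f \<longrightarrow>
        (\<exists>K. compactin T K \<and> (\<forall>x\<in>topspace T - K. f x = 0)) \<longrightarrow>
        ((\<lambda>u. \<integral>x. f x \<partial>\<mu> u) \<longlongrightarrow> (\<integral>x. f x \<partial>\<nu>)) at_top)"

definition weak_conv_at_top :: "'a topology \<Rightarrow> (real \<Rightarrow> 'a measure) \<Rightarrow> 'a measure \<Rightarrow> bool" where
  "weak_conv_at_top T \<mu> \<nu> \<longleftrightarrow>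
     (\<forall>f :: 'a \<Rightarrow> real.
        continuous_map T euclideanreal f \<longrightarrow>
        bounded (f ` topspace T) \<longrightarrow>
        ((\<lambda>u. \<integral>x. f x \<partial>\<mu> u) \<longlongrightarrow> (\<integral>x. f x \<partial>\<nu>)) at_top)"

section \<open>Regularly varying time series and their tail processes\<close>

definition stationary :: "'w measure \<Rightarrow> ('w \<Rightarrow> int \<Rightarrow> 'a::topological_space) \<Rightarrow> bool" where
  "stationary M X \<longleftrightarrow>
     (\<forall>h. distr M borel (\<lambda>\<omega> j. X \<omega> (j + h)) = distr M borel X)"

definition exceedance ::
  "('a \<Rightarrow> real) \<Rightarrow> 'w measure \<Rightarrow> ('w \<Rightarrow> int \<Rightarrow> 'a) \<Rightarrow> real \<Rightarrow> 'w set" where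
  "exceedance N M X u = {\<omega> \<in> space M. N (X \<omega> 0) > u}"

definition scaled_window ::
  "('w \<Rightarrow> int \<Rightarrow> 'a::real_vector) \<Rightarrow> int \<Rightarrow> int \<Rightarrow> real \<Rightarrow> 'w \<Rightarrow> int \<Rightarrow> 'a" where
  "scaled_window X s t u \<omega> = restrict (\<lambda>j. X \<omega> j /\<^sub>R u) {s..t}"

definition normalized_law ::
  "('a \<Rightarrow> real) \<Rightarrow> 'w measure \<Rightarrow> ('w \<Rightarrow> int \<Rightarrow> 'a::real_normed_vector) \<Rightarrow>
     int \<Rightarrow> int \<Rightarrow> real \<Rightarrow> (int \<Rightarrow> 'a) measure" where
  "normalized_law N M X s t u =
     scale_measure (1 / emeasure M (exceedance N M X u))
       (restrict_space (distr M (window_borel s t) (scaled_window X s t u)) (- {window_zero s t}))"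

definition regularly_varying ::
  "('a \<Rightarrow> real) \<Rightarrow> 'w measure \<Rightarrow> ('w \<Rightarrow> int \<Rightarrow> 'a::real_normed_vector) \<Rightarrow> bool" where
  "regularly_varying N M X \<longleftrightarrow>
     (\<forall>s t. s \<le> t \<longrightarrow>
        (\<exists>\<nu>. radon_on (punctured_top s t) \<nu> \<and> emeasure \<nu> (space \<nu>) \<noteq> 0 \<and>
             vague_conv_at_top (punctured_top s t) (normalized_law N M X s t) \<nu>))"

definition tail_index ::
  "('a \<Rightarrow> real) \<Rightarrow> 'w measure \<Rightarrow> ('w \<Rightarrow> int \<Rightarrow> 'a) \<Rightarrow> real \<Rightarrow> bool" where
  "tail_index N M X \<alpha> \<longleftrightarrow>
     (\<forall>y>0. ((\<lambda>u. measure M (exceedance N M X (u * y)) / measure M (exceedance N M X u))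
              \<longlongrightarrow> y powr (- \<alpha>)) at_top)"

definition tail_process ::
  "('a \<Rightarrow> real) \<Rightarrow> real \<Rightarrow> 'w measure \<Rightarrow> ('w \<Rightarrow> int \<Rightarrow> 'a::real_normed_vector) \<Rightarrow>
     'v measure \<Rightarrow> ('v \<Rightarrow> int \<Rightarrow> 'a) \<Rightarrow> bool" where
  "tail_process N \<alpha> M X P Y \<longleftrightarrow>
     (\<forall>y\<ge>1. measure P {\<omega> \<in> space P. N (Y \<omega> 0) > y} = y powr (- \<alpha>)) \<and>
     (\<forall>s t. s \<le> t \<longrightarrow>
        weak_conv_at_top (window_top s t)
          (\<lambda>u. distr (uniform_measure M (exceedance N M X u)) (window_borel s t)
                 (scaled_window X s t u))
          (distr P (window_borel s t) (\<lambda>\<omega>. restrict (Y \<omega>) {s..t})))"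

definition spectral_tail_process ::
  "('a \<Rightarrow> real) \<Rightarrow> ('v \<Rightarrow> int \<Rightarrow> 'a::real_vector) \<Rightarrow> 'v \<Rightarrow> int \<Rightarrow> 'a" where
  "spectral_tail_process N Y \<omega> j = Y \<omega> j /\<^sub>R N (Y \<omega> 0)"

definition candidate_extremal_index ::
  "('a \<Rightarrow> real) \<Rightarrow> 'v measure \<Rightarrow> ('v \<Rightarrow> int \<Rightarrow> 'a) \<Rightarrow> real" where
  "candidate_extremal_index N P Y = measure P {\<omega> \<in> space P. path_sup N {1..} (Y \<omega>) \<le> 1}"

text \<open>The law of Q is that of the normalized tail process, conditionally on no exceedance of 1 at
  negative times. The conversion to the reals only matters on paths with infinite supremum,
  which form a null set whenever the tail process almost surely tends to 0.\<close>

definition Q_process ::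
  "('a \<Rightarrow> real) \<Rightarrow> 'v measure \<Rightarrow> ('v \<Rightarrow> int \<Rightarrow> 'a::real_normed_vector) \<Rightarrow>
     'q measure \<Rightarrow> ('q \<Rightarrow> int \<Rightarrow> 'a) \<Rightarrow> bool" where
  "Q_process N P Y R Q \<longleftrightarrow>
     distr R borel Q =
       distr (uniform_measure P {\<omega> \<in> space P. path_sup N {..-1} (Y \<omega>) \<le> 1}) borel
         (\<lambda>\<omega> j. Y \<omega> j /\<^sub>R enn2real (path_sup N UNIV (Y \<omega>)))"

end

theory Submission
  imports Defs
begin

text \<open>
  Say that a condition on paths is an anchor if every path that vanishes at infinity and exceeds 1 in
  norm at time 0 has exactly one exceedance from which, taken as the new time origin, the condition
  holds. Three conditions are anchors: there is no exceedance at negative times (the origin is the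
  first exceedance), there is none at positive times (it is the last one), and the infargmax is 0.

  The theorem follows from an exchange principle (\<open>exceedance_anchor_exchange\<close>): for a shift
  invariant G, the expectation of G(Y) on the event that an anchor holds is the same for all anchors.
  Exchanging last and first exceedance with G = 1 shows that the extremal index is the probability
  of the conditioning event in the definition of Q. Hence the left-hand side is the expectation of
  G(Y) on this event, with G(y) = H(y / y*), where y* is the supremum of the norms of the path y.
  Exchanging first exceedance and infargmax turns it into the expectation of G(Y) on the
  event that the infargmax of Y is 0. There the supremum of Y is the norm of \<open>Y 0\<close>, so that the
  normalized path is the spectral tail process; and the infargmax does not change when a path
  is multiplied by a positive number.

  The exchange principle is a mass transport argument. Split the event that one anchor holds at 0
  according to the exceedance j at which the other one holds, move the origin to j for
  each j, and sum up again. Moving the origin is legitimate because the law of the tail process is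
  invariant under a shift from one exceedance to another (\<open>tail_process_time_change\<close>).
  This follows from the defining weak limits: conditionally on an exceedance at time 0, the
  expectation of a function that vanishes unless there are exceedances at both times 0 and j is an
  unconditional expectation divided by the probability of an exceedance, and stationarity of X shifts
  the former.
\<close>

section \<open>Norms and continuous approximation\<close>

lemma is_norm_nonneg:
  assumes "is_norm N"
  shows "0 \<le> N x"
proof -
  have tri: "\<And>x y. N (x + y) \<le> N x + N y" and sc: "\<And>c x. N (c *\<^sub>R x) = \<bar>c\<bar> * N x"
    and z: "\<And>x. N x = 0 \<longleftrightarrow> x = 0"
    using assms by (auto simp: is_norm_def)
  have "N (x + (-1) *\<^sub>R x) \<le> N x + N x"
    using tri[of x "(-1) *\<^sub>R x"] sc[of "-1" x] by simp
  moreover have "N (x + (-1) *\<^sub>R x) = 0" by (simp add: z)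
  ultimately show ?thesis by simp
qed

lemma is_norm_scale: "is_norm N \<Longrightarrow> N (c *\<^sub>R x) = \<bar>c\<bar> * N x"
  by (simp add: is_norm_def)

lemma is_norm_continuous:
  fixes N :: "'a::euclidean_space \<Rightarrow> real"
  assumes "is_norm N"
  shows "continuous_on UNIV N"
proof (rule convex_on_continuous)
  show "convex_on UNIV N"
  proof (rule convex_onI)
    fix t :: real and x y :: 'a
    assume t: "0 < t" "t < 1"
    have "N ((1 - t) *\<^sub>R x + t *\<^sub>R y) \<le> N ((1 - t) *\<^sub>R x) + N (t *\<^sub>R y)"
      using assms unfolding is_norm_def by blast
    then show "N ((1 - t) *\<^sub>R x + t *\<^sub>R y) \<le> (1 - t) * N x + t * N y"
      using t by (simp add: is_norm_scale[OF assms])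
  qed simp
qed simp

text \<open>The approximating functions vanish outside the set itself, not just outside a
  neighbourhood of it. This is what will let them force exceedances strictly above 1, even if the
  tail process hits level 1 with positive probability.\<close>

lemma open_indicator_limit:
  fixes U :: "'a::metric_space set"
  assumes "open U"
  obtains g :: "nat \<Rightarrow> 'a \<Rightarrow> real"
    where "\<And>n. continuous_on UNIV (g n)" "\<And>n x. 0 \<le> g n x" "\<And>n x. g n x \<le> 1"
      "\<And>n x. g n x \<noteq> 0 \<Longrightarrow> x \<in> U" "\<And>x. (\<lambda>n. g n x) \<longlonglongrightarrow> indicator U x"
proof (cases "U = UNIV")
  case True
  show ?thesis by (rule that[of "\<lambda>_ _. 1"]) (auto simp: True)
next
  case False
  define g where "g n x = min 1 (real n * infdist x (- U))" for n x
  show ?thesis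
  proof (rule that)
    show "continuous_on UNIV (g n)" for n
      unfolding g_def by (intro continuous_intros)
    show "0 \<le> g n x" "g n x \<le> 1" for n x
      by (auto simp: g_def infdist_nonneg)
    show "x \<in> U" if "g n x \<noteq> 0" for n x
      using that by (auto simp: g_def intro: ccontr)
    show "(\<lambda>n. g n x) \<longlonglongrightarrow> indicator U x" for x
    proof (cases "x \<in> U")
      case False
      then show ?thesis by (simp add: g_def)
    next
      case True
      have "infdist x (- U) \<noteq> 0"
        using True False assms in_closed_iff_infdist_zero[of "- U" x] by auto
      then have pos: "infdist x (- U) > 0" using infdist_nonneg[of x "- U"] by simp
      obtain n0 :: nat where n0: "1 / infdist x (- U) < real n0" using reals_Archimedean2 by blast
      have "g n x = 1" if "n \<ge> n0" for n
      proof -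
        have "1 / infdist x (- U) \<le> real n" using n0 that by linarith
        then show ?thesis using pos by (simp add: g_def field_simps min_def)
      qed
      then have "eventually (\<lambda>n. g n x = 1) sequentially"
        using eventually_sequentially by auto
      then show ?thesis using True by (simp add: tendsto_eventually)
    qed
  qed
qed

section \<open>Invariance of the tail process under a change of the exceedance time\<close>

lemma measurable_path_coordinate:
  fixes X :: "'w \<Rightarrow> int \<Rightarrow> 'a::second_countable_topology"
  assumes "X \<in> borel_measurable M"
  shows "(\<lambda>\<omega>. X \<omega> i) \<in> borel_measurable M"
  using measurable_compose[OF assms measurable_product_coordinates[of i]] .

text \<open>Because the factor with index c vanishes unless its argument exceeds 1, the product looked at
  from time c forces an exceedance at time 0. The conditional expectation is therefore an
  unconditional one over the probability of an exceedance, a form in which only the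
  numerator depends on c.\<close>

lemma tail_process_prod_limit:
  fixes N :: "'a::euclidean_space \<Rightarrow> real" and X :: "'w \<Rightarrow> int \<Rightarrow> 'a"
    and g :: "int \<Rightarrow> 'a \<Rightarrow> real"
  assumes N: "is_norm N" and X: "X \<in> borel_measurable M" and Y: "Y \<in> borel_measurable P"
    and tp: "tail_process N \<alpha> M X P Y"
    and S: "finite S" "c \<in> S"
    and cont: "\<And>i. continuous_on UNIV (g i)"
    and g0: "\<And>i x. 0 \<le> g i x" and g1: "\<And>i x. g i x \<le> 1"
    and supp: "\<And>x. g c x \<noteq> 0 \<Longrightarrow> N x > 1"
  shows "((\<lambda>u. enn2real ((\<integral>\<^sup>+\<omega>. ennreal (\<Prod>i\<in>S. g i (X \<omega> (i - c) /\<^sub>R u)) \<partial>M)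
              / emeasure M (exceedance N M X u)))
          \<longlongrightarrow> (\<integral>\<omega>. (\<Prod>i\<in>S. g i (Y \<omega> (i - c))) \<partial>P)) at_top"
proof -
  define m where "m = Max ((\<lambda>i. \<bar>i - c\<bar>) ` S)"
  have m: "i - c \<in> {-m..m}" if "i \<in> S" for i
  proof -
    have "\<bar>i - c\<bar> \<le> m" unfolding m_def using S that by (intro Max_ge) auto
    then show ?thesis by auto
  qed
  have m0: "- m \<le> m" "0 \<in> {-m..m}" using m[OF S(2)] by auto
  define f where "f w = (\<Prod>i\<in>S. g i (w (i - c)))" for w :: "int \<Rightarrow> 'a"
  have f01: "0 \<le> f w" "f w \<le> 1" for w
    unfolding f_def by (auto intro!: prod_nonneg prod_le_1 simp: g0 g1)
  have gm: "g i \<in> borel_measurable borel" for i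
    by (rule borel_measurable_continuous_onI[OF cont])
  have fm: "f \<in> borel_measurable (window_borel (-m) m)"
    unfolding f_def window_borel_def
  proof (rule borel_measurable_prod)
    fix i assume "i \<in> S"
    have w: "(\<lambda>w :: int \<Rightarrow> 'a. w (i - c)) \<in> measurable (PiM {-m..m} (\<lambda>_. borel)) borel"
      by (rule measurable_component_singleton[OF m[OF \<open>i \<in> S\<close>]])
    show "(\<lambda>w. g i (w (i - c))) \<in> borel_measurable (PiM {-m..m} (\<lambda>_. borel))"
      by (rule measurable_compose[OF w gm])
  qed
  have fc: "continuous_map (window_top (-m) m) euclideanreal f"
    unfolding f_def window_top_def
  proof (intro continuous_map_prod S)
    fix i assume "i \<in> S"
    have "continuous_map (product_topology (\<lambda>_. euclidean) {-m..m}) euclidean (\<lambda>w. w (i - c))"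
      by (rule continuous_map_product_projection) (use m[OF \<open>i \<in> S\<close>] in auto)
    moreover have "continuous_map euclidean euclidean (g i)" using cont by simp
    ultimately show "continuous_map (product_topology (\<lambda>_. euclidean) {-m..m}) euclideanreal
        (\<lambda>w. g i (w (i - c)))"
      using continuous_map_compose unfolding comp_def by blast
  qed
  have fb: "bounded (f ` topspace (window_top (-m) m))"
    by (rule boundedI[of _ 1]) (auto simp: abs_of_nonneg[OF f01(1)] f01(2))
  have sm: "scaled_window X (-m) m u \<in> measurable M (window_borel (-m) m)" for u
  proof -
    have "(\<lambda>\<omega>. restrict (\<lambda>j. X \<omega> j /\<^sub>R u) {-m..m}) \<in> measurable M (window_borel (-m) m)"
      unfolding window_borel_def
      by (intro measurable_restrict borel_measurable_scaleR measurable_path_coordinate[OF X]) simp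
    then show ?thesis by (simp add: scaled_window_def[abs_def])
  qed
  have ym: "(\<lambda>\<omega>. restrict (Y \<omega>) {-m..m}) \<in> measurable P (window_borel (-m) m)"
    unfolding window_borel_def by (intro measurable_restrict measurable_path_coordinate[OF Y])
  have Nm: "N \<in> borel_measurable borel"
    by (rule borel_measurable_continuous_onI[OF is_norm_continuous[OF N]])
  have ex: "exceedance N M X u \<in> sets M" for u
  proof -
    have [measurable]: "(\<lambda>\<omega>. N (X \<omega> 0)) \<in> borel_measurable M"
      using measurable_compose[OF measurable_path_coordinate[OF X] Nm] .
    show ?thesis unfolding exceedance_def by measurable
  qed
  let ?\<mu> = "\<lambda>u. uniform_measure M (exceedance N M X u)"
  have f_restrict: "f (restrict w {-m..m}) = f w" for w
    unfolding f_def by (rule prod.cong) (use m in auto)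
  have lim: "((\<lambda>u. \<integral>x. f x \<partial>distr (?\<mu> u) (window_borel (-m) m) (scaled_window X (-m) m u))
       \<longlongrightarrow> (\<integral>x. f x \<partial>distr P (window_borel (-m) m) (\<lambda>\<omega>. restrict (Y \<omega>) {-m..m}))) at_top"
    using tp m0 fc fb unfolding tail_process_def weak_conv_at_top_def by blast
  have rhs: "(\<integral>x. f x \<partial>distr P (window_borel (-m) m) (\<lambda>\<omega>. restrict (Y \<omega>) {-m..m})) =
      (\<integral>\<omega>. (\<Prod>i\<in>S. g i (Y \<omega> (i - c))) \<partial>P)"
    by (subst integral_distr[OF ym fm]) (simp only: f_restrict, simp add: f_def)
  have lhs: "(\<integral>x. f x \<partial>distr (?\<mu> u) (window_borel (-m) m) (scaled_window X (-m) m u)) =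
      enn2real ((\<integral>\<^sup>+\<omega>. ennreal (\<Prod>i\<in>S. g i (X \<omega> (i - c) /\<^sub>R u)) \<partial>M)
              / emeasure M (exceedance N M X u))" if u: "u > 0" for u
  proof -
    have sm': "scaled_window X (-m) m u \<in> measurable (?\<mu> u) (window_borel (-m) m)"
      using sm by simp
    have fx: "f (scaled_window X (-m) m u \<omega>) = (\<Prod>i\<in>S. g i (X \<omega> (i - c) /\<^sub>R u))" for \<omega>
      unfolding scaled_window_def f_restrict by (simp add: f_def)
    have meas: "(\<lambda>\<omega>. f (scaled_window X (-m) m u \<omega>)) \<in> borel_measurable M"
      using measurable_compose[OF sm fm] .
    \<comment> \<open>The factor at time c already forces an exceedance at time 0, so the conditioning
      event can be dropped from the integrand.\<close>
    have drop: "ennreal (f (scaled_window X (-m) m u \<omega>)) * indicator (exceedance N M X u) \<omega>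
        = ennreal (f (scaled_window X (-m) m u \<omega>))" if "\<omega> \<in> space M" for \<omega>
    proof (cases "\<omega> \<in> exceedance N M X u")
      case False
      then have "N (X \<omega> 0 /\<^sub>R u) \<le> 1"
        using u that by (simp add: exceedance_def is_norm_scale[OF N] field_simps)
      then have "g c (X \<omega> (c - c) /\<^sub>R u) = 0" using supp[of "X \<omega> (c - c) /\<^sub>R u"] by fastforce
      then have "f (scaled_window X (-m) m u \<omega>) = 0"
        unfolding fx using S by (intro prod_zero) blast+
      then show ?thesis by simp
    qed simp
    have "(\<integral>x. f x \<partial>distr (?\<mu> u) (window_borel (-m) m) (scaled_window X (-m) m u)) =
        (\<integral>\<omega>. f (scaled_window X (-m) m u \<omega>) \<partial>?\<mu> u)"
      by (rule integral_distr[OF sm' fm])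
    also have "\<dots> = enn2real (\<integral>\<^sup>+\<omega>. ennreal (f (scaled_window X (-m) m u \<omega>)) \<partial>?\<mu> u)"
      by (rule integral_eq_nn_integral) (use meas f01 in auto)
    also have "(\<integral>\<^sup>+\<omega>. ennreal (f (scaled_window X (-m) m u \<omega>)) \<partial>?\<mu> u) =
        (\<integral>\<^sup>+\<omega>. ennreal (f (scaled_window X (-m) m u \<omega>)) * indicator (exceedance N M X u) \<omega> \<partial>M)
          / emeasure M (exceedance N M X u)"
      by (rule nn_integral_uniform_measure) (use meas ex in auto)
    also have "(\<integral>\<^sup>+\<omega>. ennreal (f (scaled_window X (-m) m u \<omega>)) * indicator (exceedance N M X u) \<omega> \<partial>M)
        = (\<integral>\<^sup>+\<omega>. ennreal (f (scaled_window X (-m) m u \<omega>)) \<partial>M)"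
      by (rule nn_integral_cong) (rule drop)
    finally show ?thesis by (simp only: fx)
  qed
  have "eventually (\<lambda>u. (\<integral>x. f x \<partial>distr (?\<mu> u) (window_borel (-m) m) (scaled_window X (-m) m u)) =
      enn2real ((\<integral>\<^sup>+\<omega>. ennreal (\<Prod>i\<in>S. g i (X \<omega> (i - c) /\<^sub>R u)) \<partial>M)
              / emeasure M (exceedance N M X u))) at_top"
    using eventually_gt_at_top[of "0::real"] by eventually_elim (rule lhs)
  from Lim_transform_eventually[OF lim this] show ?thesis by (simp only: rhs)
qed

text \<open>Both sides are limits of the previous kind, with c = 0 and c = j, and stationarity makes the
  prelimit quantities equal at every level u.\<close>

lemma tail_process_shift_prod:
  fixes N :: "'a::euclidean_space \<Rightarrow> real" and X :: "'w \<Rightarrow> int \<Rightarrow> 'a"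
    and g :: "int \<Rightarrow> 'a \<Rightarrow> real"
  assumes N: "is_norm N" and X: "X \<in> borel_measurable M" and Y: "Y \<in> borel_measurable P"
    and st: "stationary M X" and tp: "tail_process N \<alpha> M X P Y"
    and S: "finite S" "0 \<in> S" "j \<in> S"
    and cont: "\<And>i. continuous_on UNIV (g i)"
    and g0: "\<And>i x. 0 \<le> g i x" and g1: "\<And>i x. g i x \<le> 1"
    and supp: "\<And>x. g 0 x \<noteq> 0 \<Longrightarrow> N x > 1" "\<And>x. g j x \<noteq> 0 \<Longrightarrow> N x > 1"
  shows "(\<integral>\<omega>. (\<Prod>i\<in>S. g i (Y \<omega> i)) \<partial>P) = (\<integral>\<omega>. (\<Prod>i\<in>S. g i (Y \<omega> (i - j))) \<partial>P)"
proof -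
  have gm: "g i \<in> borel_measurable borel" for i
    by (rule borel_measurable_continuous_onI[OF cont])
  have st': "(\<integral>\<^sup>+\<omega>. ennreal (\<Prod>i\<in>S. g i (X \<omega> (i - j) /\<^sub>R u)) \<partial>M) =
      (\<integral>\<^sup>+\<omega>. ennreal (\<Prod>i\<in>S. g i (X \<omega> i /\<^sub>R u)) \<partial>M)" for u
  proof -
    define F where "F y = ennreal (\<Prod>i\<in>S. g i (y i /\<^sub>R u))" for y :: "int \<Rightarrow> 'a"
    have F: "F \<in> borel_measurable borel"
      unfolding F_def
      by (intro measurable_compose[OF _ measurable_ennreal] borel_measurable_prod
          measurable_compose[OF _ gm] borel_measurable_scaleR measurable_product_coordinates) simp
    have sX: "(\<lambda>\<omega> i. X \<omega> (i + - j)) \<in> borel_measurable M"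
      by (rule measurable_coordinatewise_then_product) (rule measurable_path_coordinate[OF X])
    have "(\<integral>\<^sup>+\<omega>. F (\<lambda>i. X \<omega> (i + - j)) \<partial>M) = (\<integral>\<^sup>+y. F y \<partial>distr M borel (\<lambda>\<omega> i. X \<omega> (i + - j)))"
      using nn_integral_distr[OF sX] F by simp
    also have "distr M borel (\<lambda>\<omega> i. X \<omega> (i + - j)) = distr M borel X"
      using st unfolding stationary_def by blast
    also have "(\<integral>\<^sup>+y. F y \<partial>distr M borel X) = (\<integral>\<^sup>+\<omega>. F (X \<omega>) \<partial>M)"
      using nn_integral_distr[OF X] F by simp
    finally show ?thesis by (simp add: F_def)
  qed
  have lim: "((\<lambda>u. enn2real ((\<integral>\<^sup>+\<omega>. ennreal (\<Prod>i\<in>S. g i (X \<omega> (i - c) /\<^sub>R u)) \<partial>M)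
              / emeasure M (exceedance N M X u)))
          \<longlongrightarrow> (\<integral>\<omega>. (\<Prod>i\<in>S. g i (Y \<omega> (i - c))) \<partial>P)) at_top"
    if "c \<in> S" "\<And>x. g c x \<noteq> 0 \<Longrightarrow> N x > 1" for c
    using tail_process_prod_limit[where g = g and S = S and c = c, OF N X Y tp S(1) that(1) cont g0 g1 that(2)]
    by blast
  have "((\<lambda>u. enn2real ((\<integral>\<^sup>+\<omega>. ennreal (\<Prod>i\<in>S. g i (X \<omega> i /\<^sub>R u)) \<partial>M)
              / emeasure M (exceedance N M X u)))
          \<longlongrightarrow> (\<integral>\<omega>. (\<Prod>i\<in>S. g i (Y \<omega> (i - j))) \<partial>P)) at_top"
    using lim[OF S(3) supp(2)] unfolding st' by blast
  moreover have "((\<lambda>u. enn2real ((\<integral>\<^sup>+\<omega>. ennreal (\<Prod>i\<in>S. g i (X \<omega> i /\<^sub>R u)) \<partial>M)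
              / emeasure M (exceedance N M X u)))
          \<longlongrightarrow> (\<integral>\<omega>. (\<Prod>i\<in>S. g i (Y \<omega> i)) \<partial>P)) at_top"
    using lim[OF S(2) supp(1)] unfolding diff_0_right by blast
  ultimately show ?thesis using tendsto_unique[OF trivial_limit_at_top_linorder] by blast
qed

lemma tail_process_shift_open_box:
  fixes N :: "'a::euclidean_space \<Rightarrow> real" and X :: "'w \<Rightarrow> int \<Rightarrow> 'a"
    and U :: "int \<Rightarrow> 'a set"
  assumes N: "is_norm N" and X: "X \<in> borel_measurable M"
    and P: "prob_space P" and Y: "Y \<in> borel_measurable P"
    and st: "stationary M X" and tp: "tail_process N \<alpha> M X P Y"
    and S: "finite S" "0 \<in> S" "j \<in> S"
    and U: "\<And>i. open (U i)" and supp: "U 0 \<subseteq> {x. N x > 1}" "U j \<subseteq> {x. N x > 1}"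
  shows "measure P {\<omega> \<in> space P. \<forall>i\<in>S. Y \<omega> i \<in> U i} =
    measure P {\<omega> \<in> space P. \<forall>i\<in>S. Y \<omega> (i - j) \<in> U i}"
proof -
  interpret prob_space P by fact
  have "\<exists>h. (\<forall>n. continuous_on UNIV (h n)) \<and> (\<forall>n x. 0 \<le> h n x) \<and> (\<forall>n x. h n x \<le> (1::real)) \<and>
      (\<forall>n x. h n x \<noteq> 0 \<longrightarrow> x \<in> U i) \<and> (\<forall>x. (\<lambda>n::nat. h n x) \<longlonglongrightarrow> indicator (U i) x)" for i
    by (rule open_indicator_limit[OF U[of i]]) blast
  then obtain h where h: "\<And>i n. continuous_on UNIV (h i n)" "\<And>i n x. 0 \<le> h i n x"
      "\<And>i n x. h i n x \<le> (1::real)" "\<And>i n x. h i n x \<noteq> 0 \<Longrightarrow> x \<in> U i"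
      "\<And>i x. (\<lambda>n::nat. h i n x) \<longlonglongrightarrow> indicator (U i) x"
    by metis
  have hm: "h i n \<in> borel_measurable borel" for i n
    by (rule borel_measurable_continuous_onI[OF h(1)])
  have lim: "(\<lambda>n. \<integral>\<omega>. (\<Prod>i\<in>S. h i n (Y \<omega> (i - c))) \<partial>P) \<longlonglongrightarrow>
      measure P {\<omega> \<in> space P. \<forall>i\<in>S. Y \<omega> (i - c) \<in> U i}" for c
  proof -
    have Um: "U i \<in> sets borel" for i using U by simp
    have [measurable]: "(\<lambda>\<omega>. Y \<omega> i) \<in> borel_measurable P" for i
      by (rule measurable_path_coordinate[OF Y])
    have set: "{\<omega> \<in> space P. \<forall>i\<in>S. Y \<omega> (i - c) \<in> U i} \<in> sets P"
      using S(1) Um by measurable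
    have "(\<lambda>n. \<integral>\<omega>. (\<Prod>i\<in>S. h i n (Y \<omega> (i - c))) \<partial>P) \<longlonglongrightarrow>
        (\<integral>\<omega>. indicator {\<omega> \<in> space P. \<forall>i\<in>S. Y \<omega> (i - c) \<in> U i} \<omega> \<partial>P)"
    proof (rule integral_dominated_convergence[where w = "\<lambda>_. 1"])
      show "(\<lambda>\<omega>. indicator {\<omega> \<in> space P. \<forall>i\<in>S. Y \<omega> (i - c) \<in> U i} \<omega> :: real) \<in> borel_measurable P"
        using set by simp
      show "(\<lambda>\<omega>. \<Prod>i\<in>S. h i n (Y \<omega> (i - c))) \<in> borel_measurable P" for n
        by (intro borel_measurable_prod measurable_compose[OF _ hm]) simp
      show "AE \<omega> in P. (\<lambda>n. \<Prod>i\<in>S. h i n (Y \<omega> (i - c))) \<longlonglongrightarrow>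
          indicator {\<omega> \<in> space P. \<forall>i\<in>S. Y \<omega> (i - c) \<in> U i} \<omega>"
      proof (rule AE_I2)
        fix \<omega> assume w: "\<omega> \<in> space P"
        have "(\<Prod>i\<in>S. indicator (U i) (Y \<omega> (i - c)) :: real) =
            indicator {\<omega> \<in> space P. \<forall>i\<in>S. Y \<omega> (i - c) \<in> U i} \<omega>"
          using w S(1) by (auto simp: indicator_def)
        then show "(\<lambda>n. \<Prod>i\<in>S. h i n (Y \<omega> (i - c))) \<longlonglongrightarrow>
            indicator {\<omega> \<in> space P. \<forall>i\<in>S. Y \<omega> (i - c) \<in> U i} \<omega>"
          using tendsto_prod[of S "\<lambda>i n. h i n (Y \<omega> (i - c))" _ sequentially, OF h(5)] by simp
      qed
      show "AE \<omega> in P. norm (\<Prod>i\<in>S. h i n (Y \<omega> (i - c))) \<le> 1" for n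
        by (intro AE_I2) (auto simp: abs_prod h intro!: prod_le_1)
    qed simp
    then show ?thesis using set by simp
  qed
  have "(\<integral>\<omega>. (\<Prod>i\<in>S. h i n (Y \<omega> i)) \<partial>P) = (\<integral>\<omega>. (\<Prod>i\<in>S. h i n (Y \<omega> (i - j))) \<partial>P)" for n
    by (rule tail_process_shift_prod[OF N X Y st tp S]) (use h(1-3) h(4) supp in \<open>blast+\<close>)
  then show ?thesis
    using lim[of 0] lim[of j] LIMSEQ_unique by (simp only: diff_0_right) blast
qed

text \<open>Laws of paths can be compared on these boxes only, since they are closed under finite
  intersections; and the indicator of a box is a limit of products of continuous functions of
  single coordinates.\<close>

lemma sets_borel_eq_open_boxes:
  "sets (borel :: (int \<Rightarrow> 'a::second_countable_topology) measure) =
    sigma_sets UNIV {Pi\<^sub>E UNIV U | U. (\<forall>i. open (U i)) \<and> finite {i. U i \<noteq> UNIV}}"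
    (is "_ = sigma_sets UNIV ?E")
proof -
  from product_topology_countable_basis[where 'a = int and 'b = 'a]
  obtain K :: "(int \<Rightarrow> 'a) set set" where "topological_basis K \<and> countable K \<and>
      (\<forall>k\<in>K. \<exists>U. k = Pi\<^sub>E UNIV U \<and> (\<forall>i. open (U i)) \<and> finite {i. U i \<noteq> UNIV})" ..
  then have K: "topological_basis K" "countable K" and KE: "K \<subseteq> ?E" by auto
  have "sets (borel :: (int \<Rightarrow> 'a) measure) = sigma_sets UNIV K"
    by (subst borel_eq_countable_basis[OF K(2,1)]) (rule sets_measure_of, simp)
  also have "\<dots> \<subseteq> sigma_sets UNIV ?E" by (rule sigma_sets_mono') (rule KE)
  finally have "sets (borel :: (int \<Rightarrow> 'a) measure) \<subseteq> sigma_sets UNIV ?E" .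
  moreover have "sigma_sets UNIV ?E \<subseteq> sets (borel :: (int \<Rightarrow> 'a) measure)"
  proof -
    have "?E \<subseteq> sets (borel :: (int \<Rightarrow> 'a) measure)"
      using open_PiE by (blast intro: borel_open)
    then show ?thesis using sets.sigma_sets_subset[of ?E "borel :: (int \<Rightarrow> 'a) measure"] by simp
  qed
  ultimately show ?thesis by blast
qed

text \<open>The law of the tail process is invariant under moving the time origin from one exceedance to
  another one: restricted to paths with exceedances at 0 and j, the laws of Y and of Y delayed by
  j agree on open boxes, hence everywhere. The hypothesis on F replaces the restriction.\<close>

theorem tail_process_time_change:
  fixes N :: "'a::euclidean_space \<Rightarrow> real" and X :: "'w \<Rightarrow> int \<Rightarrow> 'a"
    and F :: "(int \<Rightarrow> 'a) \<Rightarrow> ennreal"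
  assumes N: "is_norm N" and X: "X \<in> borel_measurable M"
    and P: "prob_space P" and Y: "Y \<in> borel_measurable P"
    and st: "stationary M X" and tp: "tail_process N \<alpha> M X P Y"
    and F: "F \<in> borel_measurable borel"
    and supp: "\<And>y. F y \<noteq> 0 \<Longrightarrow> N (y 0) > 1 \<and> N (y j) > 1"
  shows "(\<integral>\<^sup>+\<omega>. F (Y \<omega>) \<partial>P) = (\<integral>\<^sup>+\<omega>. F (\<lambda>i. Y \<omega> (i - j)) \<partial>P)"
proof -
  interpret prob_space P by fact
  define W where "W = {x. N x > 1}"
  have Wo: "open W"
    unfolding W_def using is_norm_continuous[OF N] by (intro open_Collect_less) auto
  define V where "V = {y :: int \<Rightarrow> 'a. y 0 \<in> W \<and> y j \<in> W}"
  have Vm[measurable]: "V \<in> sets borel"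
  proof -
    have "V = {y \<in> space borel. y 0 \<in> W} \<inter> {y \<in> space borel. y j \<in> W}" by (auto simp: V_def)
    moreover have "{y \<in> space borel. (y :: int \<Rightarrow> 'a) i \<in> W} \<in> sets borel" for i
      using measurable_sets[OF measurable_product_coordinates[of i] borel_open[OF Wo]]
      by (simp add: vimage_def)
    ultimately show ?thesis by (simp only: sets.Int)
  qed
  define B where "B \<omega> = (\<lambda>i. Y \<omega> (i - j))" for \<omega>
  have B: "B \<in> borel_measurable P"
    unfolding B_def
    by (rule measurable_coordinatewise_then_product) (rule measurable_path_coordinate[OF Y])
  define \<nu> where "\<nu> Z = density (distr P borel Z) (indicator V)" for Z :: "'b \<Rightarrow> int \<Rightarrow> 'a"
  have \<nu>_sets: "sets (\<nu> Z) = sets borel" for Z by (simp add: \<nu>_def)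
  have \<nu>_em: "emeasure (\<nu> Z) E = ennreal (measure P {\<omega> \<in> space P. Z \<omega> \<in> E \<and> Z \<omega> \<in> V})"
    if Z: "Z \<in> borel_measurable P" and E: "E \<in> sets borel" for Z E
  proof -
    have "emeasure (\<nu> Z) E = (\<integral>\<^sup>+y. indicator V y * indicator E y \<partial>distr P borel Z)"
      unfolding \<nu>_def by (rule emeasure_density) (use E in auto)
    also have "\<dots> = (\<integral>\<^sup>+y. indicator (E \<inter> V) y \<partial>distr P borel Z)"
      by (rule nn_integral_cong) (auto simp: indicator_def)
    also have "\<dots> = emeasure (distr P borel Z) (E \<inter> V)"
      using E by (intro nn_integral_indicator) auto
    also have "\<dots> = emeasure P {\<omega> \<in> space P. Z \<omega> \<in> E \<and> Z \<omega> \<in> V}"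
      using E by (subst emeasure_distr[OF Z]) (auto intro!: arg_cong[where f = "emeasure P"])
    finally show ?thesis by (simp add: emeasure_eq_measure)
  qed
  let ?E = "{Pi\<^sub>E UNIV U | U :: int \<Rightarrow> 'a set. (\<forall>i. open (U i)) \<and> finite {i. U i \<noteq> UNIV}}"
  have "\<nu> Y = \<nu> B"
  proof (rule measure_eqI_generator_eq[where E = ?E and \<Omega> = UNIV and A = "\<lambda>_. UNIV"])
    show "Int_stable ?E"
    proof (rule Int_stableI)
      fix a b assume "a \<in> ?E" "b \<in> ?E"
      then obtain U U' where U: "a = Pi\<^sub>E UNIV U" "\<And>i. open (U i)" "finite {i. U i \<noteq> UNIV}"
        and U': "b = Pi\<^sub>E UNIV U'" "\<And>i. open (U' i)" "finite {i. U' i \<noteq> UNIV}" by auto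
      have "a \<inter> b = Pi\<^sub>E UNIV (\<lambda>i. U i \<inter> U' i)" by (simp add: U U' PiE_Int)
      moreover have "finite {i. U i \<inter> U' i \<noteq> UNIV}"
        by (rule finite_subset[OF _ finite_UnI[OF U(3) U'(3)]]) auto
      moreover have "\<forall>i. open (U i \<inter> U' i)" using U U' by auto
      ultimately show "a \<inter> b \<in> ?E" by (intro CollectI exI[of _ "\<lambda>i. U i \<inter> U' i"]) simp
    qed
    show "emeasure (\<nu> Y) E = emeasure (\<nu> B) E" if E: "E \<in> ?E" for E
    proof -
      obtain U where U: "E = Pi\<^sub>E UNIV U" "\<And>i. open (U i)" "finite {i. U i \<noteq> UNIV}"
        using E by auto
      have Em: "E \<in> sets borel" using U open_PiE by (blast intro: borel_open)
      \<comment> \<open>A box intersected with V is again a box, with its sides at 0 and j cut down to W.\<close>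
      define S where "S = {i. U i \<noteq> UNIV} \<union> {0, j}"
      define U' where "U' i = (if i \<in> {0, j} then U i \<inter> W else U i)" for i
      have eq: "y \<in> E \<and> y \<in> V \<longleftrightarrow> (\<forall>i\<in>S. y i \<in> U' i)" for y
      proof
        assume "y \<in> E \<and> y \<in> V"
        then show "\<forall>i\<in>S. y i \<in> U' i" by (auto simp: U(1) V_def U'_def)
      next
        assume *: "\<forall>i\<in>S. y i \<in> U' i"
        then have "y 0 \<in> U' 0" "y j \<in> U' j" by (auto simp: S_def)
        then have "y \<in> V" by (auto simp: V_def U'_def)
        moreover have "y i \<in> U i" for i
        proof (cases "i \<in> S")
          case True
          then have "y i \<in> U' i" using * by blast
          then show ?thesis by (auto simp: U'_def split: if_splits)
        next
          case False
          then show ?thesis by (simp add: S_def)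
        qed
        ultimately show "y \<in> E \<and> y \<in> V" by (simp add: U(1) PiE_iff)
      qed
      have "measure P {\<omega> \<in> space P. \<forall>i\<in>S. Y \<omega> i \<in> U' i} =
          measure P {\<omega> \<in> space P. \<forall>i\<in>S. Y \<omega> (i - j) \<in> U' i}"
        by (rule tail_process_shift_open_box[OF N X P Y st tp])
          (use U Wo in \<open>auto simp: S_def U'_def W_def\<close>)
      then show ?thesis
        unfolding \<nu>_em[OF Y Em] \<nu>_em[OF B Em] eq by (simp add: B_def)
    qed
    show "sets (\<nu> Y) = sigma_sets UNIV ?E" "sets (\<nu> B) = sigma_sets UNIV ?E"
      unfolding \<nu>_sets by (rule sets_borel_eq_open_boxes)+
    show "range (\<lambda>_::nat. UNIV) \<subseteq> ?E"
      by (auto intro!: exI[of _ "\<lambda>_. UNIV"])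
    show "emeasure (\<nu> Y) UNIV \<noteq> \<infinity>" by (simp add: \<nu>_em[OF Y])
  qed auto
  have int: "(\<integral>\<^sup>+\<omega>. F (Z \<omega>) \<partial>P) = (\<integral>\<^sup>+y. F y \<partial>\<nu> Z)" if Z: "Z \<in> borel_measurable P" for Z
  proof -
    have "(\<integral>\<^sup>+y. F y \<partial>\<nu> Z) = (\<integral>\<^sup>+y. indicator V y * F y \<partial>distr P borel Z)"
      unfolding \<nu>_def by (rule nn_integral_density) (use F in auto)
    also have "\<dots> = (\<integral>\<^sup>+y. F y \<partial>distr P borel Z)"
      by (rule nn_integral_cong) (use supp in \<open>auto simp: indicator_def V_def W_def\<close>)
    also have "\<dots> = (\<integral>\<^sup>+\<omega>. F (Z \<omega>) \<partial>P)"
      using nn_integral_distr[OF Z] F by simp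
    finally show ?thesis by simp
  qed
  show ?thesis using int[OF Y] int[OF B] \<open>\<nu> Y = \<nu> B\<close> by (simp add: B_def)
qed

section \<open>Exchanging the anchors of a cluster of exceedances\<close>

definition shift_path :: "int \<Rightarrow> (int \<Rightarrow> 'a) \<Rightarrow> int \<Rightarrow> 'a" where
  "shift_path k y = (\<lambda>i. y (i + k))"

lemma shift_path_0 [simp]: "shift_path 0 y = y"
  by (simp add: shift_path_def)

lemma shift_path_uminus: "shift_path (- k) y = (\<lambda>i. y (i - k))"
  by (simp add: shift_path_def)

lemma measurable_shift_path [measurable]:
  "shift_path k \<in> borel_measurable (borel :: (int \<Rightarrow> 'a::second_countable_topology) measure)"
  unfolding shift_path_def
  by (rule measurable_coordinatewise_then_product) (rule measurable_product_coordinates)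

lemma shift_invariant_shift_path:
  assumes "shift_invariant H"
  shows "H (shift_path k y) = H y"
proof -
  have step: "H (shift_path (k - 1) y) = H (shift_path k y)" for k
  proof -
    have "shift_path (k - 1) y = backshift (shift_path k y)"
      by (simp add: shift_path_def backshift_def fun_eq_iff algebra_simps)
    then show ?thesis using assms by (simp add: shift_invariant_def)
  qed
  show ?thesis
  proof (induction k rule: int_induct[where k = 0])
    case (step1 i)
    then show ?case using step[of "i + 1"] by simp
  next
    case (step2 i)
    then show ?case using step[of i] by simp
  qed simp
qed

definition vanishing_path :: "('a \<Rightarrow> real) \<Rightarrow> (int \<Rightarrow> 'a) \<Rightarrow> bool" where
  "vanishing_path N y \<longleftrightarrow> ((\<lambda>k. N (y k)) \<longlongrightarrow> 0) (filtercomap abs at_top)"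

text \<open>An anchor singles out one exceedance in the cluster of exceedances of a path, in a way that does
  not depend on which of them happens to be the time origin.\<close>

definition exceedance_anchor ::
  "('a::topological_space \<Rightarrow> real) \<Rightarrow> ((int \<Rightarrow> 'a) \<Rightarrow> bool) \<Rightarrow> bool" where
  "exceedance_anchor N A \<longleftrightarrow> Measurable.pred borel A \<and>
     (\<forall>y. vanishing_path N y \<longrightarrow> N (y 0) > 1 \<longrightarrow> (\<exists>!k. N (y k) > 1 \<and> A (shift_path k y)))"

lemma nn_integral_count_space_ex1:
  assumes "\<exists>!j. R j"
  shows "(\<integral>\<^sup>+j. c * indicator {j. R j} j \<partial>count_space UNIV) = (c :: ennreal)"
proof -
  obtain k where "{j. R j} = {k}" using assms by auto
  then show ?thesis by (simp add: nn_integral_cmult)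
qed

text \<open>Mass transport between two anchors: each path for which A holds at the origin sends its mass
  to the unique exceedance at which A' holds. Seen from there, each path for which A' holds
  at the origin receives mass from the unique exceedance at which A holds.\<close>

lemma exceedance_anchor_exchange:
  fixes N :: "'a::euclidean_space \<Rightarrow> real" and X :: "'w \<Rightarrow> int \<Rightarrow> 'a"
    and G :: "(int \<Rightarrow> 'a) \<Rightarrow> ennreal"
  assumes N: "is_norm N" and X: "X \<in> borel_measurable M"
    and P: "prob_space P" and Y: "Y \<in> borel_measurable P"
    and st: "stationary M X" and tp: "tail_process N \<alpha> M X P Y"
    and Y0: "AE \<omega> in P. vanishing_path N (Y \<omega>)" and Y1: "AE \<omega> in P. N (Y \<omega> 0) > 1"
    and G: "G \<in> borel_measurable borel" "shift_invariant G"
    and A: "exceedance_anchor N A" and A': "exceedance_anchor N A'"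
  shows "(\<integral>\<^sup>+\<omega>. G (Y \<omega>) * indicator {y. A y} (Y \<omega>) \<partial>P) =
    (\<integral>\<^sup>+\<omega>. G (Y \<omega>) * indicator {y. A' y} (Y \<omega>) \<partial>P)"
proof -
  have [measurable]: "Measurable.pred borel A" "Measurable.pred borel A'"
    using A A' by (auto simp: exceedance_anchor_def)
  note G(1)[measurable] Y[measurable]
  have Nm[measurable]: "N \<in> borel_measurable borel"
    by (rule borel_measurable_continuous_onI[OF is_norm_continuous[OF N]])
  note G_shift = shift_invariant_shift_path[OF G(2)]
  \<comment> \<open>F j is the mass sent from the origin to time j. The indicator at time 0 does not change it
    almost surely, but is required for the change of time origin.\<close>
  define F where "F j y = G y * indicator {y. A y} y *
      indicator {j. N (y j) > 1 \<and> A' (shift_path j y)} j * indicator {y. N (y 0) > 1} y" for j y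
  have Fm[measurable]: "F j \<in> borel_measurable borel" for j
  proof -
    have "F j = (\<lambda>y. G y * indicator {y. A y} y *
        indicator {y. N (y j) > 1 \<and> A' (shift_path j y)} y * indicator {y. N (y 0) > 1} y)"
      by (auto simp: F_def fun_eq_iff indicator_def)
    also have "\<dots> \<in> borel_measurable borel" by measurable
    finally show ?thesis .
  qed
  have "(\<integral>\<^sup>+\<omega>. G (Y \<omega>) * indicator {y. A y} (Y \<omega>) \<partial>P) =
      (\<integral>\<^sup>+\<omega>. (\<integral>\<^sup>+j. F j (Y \<omega>) \<partial>count_space UNIV) \<partial>P)"
  proof (rule nn_integral_cong_AE, use Y0 Y1 in eventually_elim)
    case (elim \<omega>)
    then have "\<exists>!k. N (Y \<omega> k) > 1 \<and> A' (shift_path k (Y \<omega>))"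
      using A' by (simp add: exceedance_anchor_def)
    from nn_integral_count_space_ex1[OF this, of "G (Y \<omega>) * indicator {y. A y} (Y \<omega>)"] elim
    show ?case by (simp add: F_def)
  qed
  also have "\<dots> = (\<integral>\<^sup>+j. (\<integral>\<^sup>+\<omega>. F j (Y \<omega>) \<partial>P) \<partial>count_space UNIV)"
    by (rule nn_integral_count_space_nn_integral) measurable
  also have "\<dots> = (\<integral>\<^sup>+j. (\<integral>\<^sup>+\<omega>. F j (shift_path (- j) (Y \<omega>)) \<partial>P) \<partial>count_space UNIV)"
  proof (rule nn_integral_cong)
    fix j :: int
    show "(\<integral>\<^sup>+\<omega>. F j (Y \<omega>) \<partial>P) = (\<integral>\<^sup>+\<omega>. F j (shift_path (- j) (Y \<omega>)) \<partial>P)"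
      unfolding shift_path_uminus
    proof (rule tail_process_time_change[OF N X P Y st tp Fm])
      show "N (y 0) > 1 \<and> N (y j) > 1" if "F j y \<noteq> 0" for y
        using that by (simp add: F_def split: split_indicator_asm)
    qed
  qed
  also have "\<dots> = (\<integral>\<^sup>+\<omega>. (\<integral>\<^sup>+j. F j (shift_path (- j) (Y \<omega>)) \<partial>count_space UNIV) \<partial>P)"
    by (rule nn_integral_count_space_nn_integral[symmetric]) measurable
  also have "\<dots> = (\<integral>\<^sup>+\<omega>. G (Y \<omega>) * indicator {y. A' y} (Y \<omega>) \<partial>P)"
  proof (rule nn_integral_cong_AE, use Y0 Y1 in eventually_elim)
    case (elim \<omega>)
    then have "\<exists>!k. N (Y \<omega> k) > 1 \<and> A (shift_path k (Y \<omega>))"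
      using A unfolding exceedance_anchor_def by blast
    then have "\<exists>!j. N (Y \<omega> (- j)) > 1 \<and> A (shift_path (- j) (Y \<omega>))"
      by (metis minus_minus)
    from nn_integral_count_space_ex1[OF this, of "G (Y \<omega>) * indicator {y. A' y} (Y \<omega>)"]
    have "(\<integral>\<^sup>+j. G (Y \<omega>) * indicator {y. A' y} (Y \<omega>) *
        indicator {j. N (Y \<omega> (- j)) > 1 \<and> A (shift_path (- j) (Y \<omega>))} j \<partial>count_space UNIV) =
        G (Y \<omega>) * indicator {y. A' y} (Y \<omega>)" .
    moreover have "F j (shift_path (- j) (Y \<omega>)) = G (Y \<omega>) * indicator {y. A' y} (Y \<omega>) *
        indicator {j. N (Y \<omega> (- j)) > 1 \<and> A (shift_path (- j) (Y \<omega>))} j" for j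
    proof -
      have "shift_path j (shift_path (- j) (Y \<omega>)) = Y \<omega>"
          "shift_path (- j) (Y \<omega>) j = Y \<omega> 0" "shift_path (- j) (Y \<omega>) 0 = Y \<omega> (- j)"
        by (simp_all add: shift_path_def)
      then show ?thesis
        using elim(2) by (simp add: F_def G_shift split: split_indicator)
    qed
    ultimately show ?case by simp
  qed
  finally show ?thesis .
qed

section \<open>The first exceedance, the last exceedance and the infargmax\<close>

lemma path_sup_le_1_iff: "path_sup N A y \<le> 1 \<longleftrightarrow> (\<forall>i\<in>A. N (y i) \<le> 1)"
  by (simp add: path_sup_def SUP_le_iff)

lemma measurable_path_sup:
  fixes N :: "'a::euclidean_space \<Rightarrow> real"
  assumes "is_norm N"
  shows "path_sup N A \<in> borel_measurable borel"
proof -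
  have [measurable]: "N \<in> borel_measurable borel"
    by (rule borel_measurable_continuous_onI[OF is_norm_continuous[OF assms]])
  have "(\<lambda>y. SUP i\<in>A. ennreal (N (y i))) \<in> borel_measurable borel"
    by (rule borel_measurable_SUP) auto
  then show ?thesis by (simp add: path_sup_def[abs_def])
qed

lemma finite_exceedances:
  assumes "vanishing_path N y"
  shows "finite {k. N (y k) > 1}"
proof -
  have "eventually (\<lambda>k. N (y k) < 1) (filtercomap abs at_top)"
    using assms unfolding vanishing_path_def by (rule order_tendstoD) simp
  then obtain b where b: "\<And>k. \<bar>k\<bar> \<ge> b \<Longrightarrow> N (y k) < 1"
    unfolding eventually_filtercomap eventually_at_top_linorder by meson
  have "k \<in> {-b..b}" if "N (y k) > 1" for k
    using b[of k] that by (cases "\<bar>k\<bar> \<ge> b") (simp_all, arith)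
  then have "{k. N (y k) > 1} \<subseteq> {-b..b}" by blast
  then show ?thesis by (rule finite_subset) simp
qed

lemma first_exceedance_anchor:
  fixes N :: "'a::euclidean_space \<Rightarrow> real"
  assumes "is_norm N"
  shows "exceedance_anchor N (\<lambda>y. path_sup N {..-1} y \<le> 1)"
  unfolding exceedance_anchor_def
proof (intro conjI allI impI)
  note measurable_path_sup[OF assms, measurable]
  show "Measurable.pred borel (\<lambda>y. path_sup N {..-1} y \<le> 1)" by measurable
  fix y assume y: "vanishing_path N y" "N (y 0) > 1"
  define T where "T = {k. N (y k) > 1}"
  have mem: "k \<in> T \<longleftrightarrow> N (y k) > 1" for k by (simp add: T_def)
  have T: "finite T" "T \<noteq> {}"
    using finite_exceedances[OF y(1)] y(2) mem by (auto simp: T_def)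
  have shifted: "path_sup N {..-1} (shift_path k y) \<le> 1 \<longleftrightarrow> (\<forall>i<k. N (y i) \<le> 1)" for k
  proof -
    have "(\<forall>i\<in>{..-1}. N (y (i + k)) \<le> 1) \<longleftrightarrow> (\<forall>i<k. N (y i) \<le> 1)"
    proof safe
      fix i assume "\<forall>i\<in>{..-1}. N (y (i + k)) \<le> 1" "i < k"
      then show "N (y i) \<le> 1" by (auto dest: bspec[of _ _ "i - k"])
    qed auto
    then show ?thesis by (simp only: path_sup_le_1_iff shift_path_def)
  qed
  show "\<exists>!k. N (y k) > 1 \<and> path_sup N {..-1} (shift_path k y) \<le> 1"
    unfolding shifted
  proof (rule ex1I[of _ "Min T"])
    show "N (y (Min T)) > 1 \<and> (\<forall>i<Min T. N (y i) \<le> 1)"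
      using Min_in[OF T] Min_le[OF T(1)] unfolding mem by (meson not_le)
    fix k assume k: "N (y k) > 1 \<and> (\<forall>i<k. N (y i) \<le> 1)"
    have "k \<in> T" using k by (simp add: mem)
    moreover have "\<not> i < k" if "i \<in> T" for i using k that unfolding mem by (meson not_le)
    ultimately show "k = Min T"
      by (intro Min_eqI[symmetric] T) (auto simp: not_less)
  qed
qed

lemma last_exceedance_anchor:
  fixes N :: "'a::euclidean_space \<Rightarrow> real"
  assumes "is_norm N"
  shows "exceedance_anchor N (\<lambda>y. path_sup N {1..} y \<le> 1)"
  unfolding exceedance_anchor_def
proof (intro conjI allI impI)
  note measurable_path_sup[OF assms, measurable]
  show "Measurable.pred borel (\<lambda>y. path_sup N {1..} y \<le> 1)" by measurable
  fix y assume y: "vanishing_path N y" "N (y 0) > 1"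
  define T where "T = {k. N (y k) > 1}"
  have mem: "k \<in> T \<longleftrightarrow> N (y k) > 1" for k by (simp add: T_def)
  have T: "finite T" "T \<noteq> {}"
    using finite_exceedances[OF y(1)] y(2) mem by (auto simp: T_def)
  have shifted: "path_sup N {1..} (shift_path k y) \<le> 1 \<longleftrightarrow> (\<forall>i>k. N (y i) \<le> 1)" for k
  proof -
    have "(\<forall>i\<in>{1..}. N (y (i + k)) \<le> 1) \<longleftrightarrow> (\<forall>i>k. N (y i) \<le> 1)"
    proof safe
      fix i assume "\<forall>i\<in>{1..}. N (y (i + k)) \<le> 1" "i > k"
      then show "N (y i) \<le> 1" by (auto dest: bspec[of _ _ "i - k"])
    qed auto
    then show ?thesis by (simp only: path_sup_le_1_iff shift_path_def)
  qed
  show "\<exists>!k. N (y k) > 1 \<and> path_sup N {1..} (shift_path k y) \<le> 1"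
    unfolding shifted
  proof (rule ex1I[of _ "Max T"])
    show "N (y (Max T)) > 1 \<and> (\<forall>i>Max T. N (y i) \<le> 1)"
      using Max_in[OF T] Max_ge[OF T(1)] unfolding mem by (meson not_le)
    fix k assume k: "N (y k) > 1 \<and> (\<forall>i>k. N (y i) \<le> 1)"
    have "k \<in> T" using k by (simp add: mem)
    moreover have "\<not> i > k" if "i \<in> T" for i using k that unfolding mem by (meson not_le)
    ultimately show "k = Max T"
      by (intro Max_eqI[symmetric] T) (auto simp: not_less)
  qed
qed

lemma path_sup_shift_path:
  "path_sup N A (shift_path k y) = path_sup N ((\<lambda>i. i + k) ` A) y"
  by (simp add: path_sup_def shift_path_def image_comp comp_def)

lemma is_infargmax_shift_path:
  "is_infargmax N (shift_path k y) 0 \<longleftrightarrow> is_infargmax N y k"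
proof -
  have "i \<in> (\<lambda>i. i + k) ` A \<longleftrightarrow> i - k \<in> A" for i A
    by (auto intro: image_eqI[of _ _ "i - k"])
  then have "(\<lambda>i. i + k) ` {..-1} = {..k - 1}" "(\<lambda>i. i + k) ` {1..} = {k + 1..}"
    by (auto simp: set_eq_iff)
  then show ?thesis by (simp add: is_infargmax_def path_sup_shift_path) (simp add: shift_path_def)
qed

text \<open>On the event that the infargmax is 0, normalizing by the supremum is the same as normalizing by
  the norm at time 0.\<close>

lemma path_sup_UNIV_infargmax:
  assumes "is_infargmax N y k"
  shows "path_sup N UNIV y = ennreal (N (y k))"
proof (rule antisym)
  have "ennreal (N (y i)) \<le> ennreal (N (y k))" for i
  proof (cases i k rule: linorder_cases)
    case less
    then have "ennreal (N (y i)) \<le> path_sup N {..k - 1} y" by (intro path_sup_upper) simp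
    then show ?thesis using assms unfolding is_infargmax_def by (meson order.trans less_imp_le)
  next
    case greater
    then have "ennreal (N (y i)) \<le> path_sup N {k + 1..} y" by (intro path_sup_upper) simp
    then show ?thesis using assms unfolding is_infargmax_def by (meson order.trans less_imp_le)
  qed simp
  then show "path_sup N UNIV y \<le> ennreal (N (y k))"
    unfolding path_sup_def by (rule SUP_least)
qed (rule path_sup_upper, simp)

text \<open>The supremum exceeds 1 and only finitely many times contribute to it: it is reached by the last
  exceedance, but not yet before the first one.\<close>

lemma vanishing_infargmax_exists:
  assumes "vanishing_path N y" and "N (y 0) > 1"
  shows "\<exists>k. is_infargmax N y k"
proof -
  define T where "T = {k. N (y k) > 1}"
  have T: "finite T" "0 \<in> T"
    using finite_exceedances[OF assms(1)] assms(2) by (simp_all add: T_def)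
  have big: "path_sup N A y > 1" if "0 \<in> A" for A
    using path_sup_le_1_iff[of N A y] that assms(2) by (meson not_le)
  have small: "path_sup N A y \<le> 1" if "A \<inter> T = {}" for A
    unfolding path_sup_le_1_iff using that by (auto simp: T_def disjoint_iff not_less)
  have U: "(UNIV :: int set) = {..Max T} \<union> {Max T + 1..}" by auto
  have "path_sup N {Max T + 1..} y \<le> 1"
    by (rule small) (use Max_ge[OF T(1)] in force)
  moreover have "path_sup N {..Max T} y > 1"
    by (rule big) (use Max_ge[OF T(1) T(2)] in simp)
  ultimately have "path_sup N UNIV y = path_sup N {..Max T} y"
    using path_sup_Un[of N "{..Max T}" "{Max T + 1..}" y] unfolding U by (simp add: max_absorb1)
  moreover have "path_sup N {..Min T - 1} y \<le> 1"
    by (rule small) (use Min_le[OF T(1)] in force)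
  then have "path_sup N UNIV y \<noteq> path_sup N {..Min T - 1} y"
    using big[of UNIV] by auto
  ultimately show ?thesis by (rule infargmax_exists)
qed

lemma infargmax_anchor:
  fixes N :: "'a::euclidean_space \<Rightarrow> real"
  assumes "is_norm N"
  shows "exceedance_anchor N (\<lambda>y. is_infargmax N y 0)"
  unfolding exceedance_anchor_def
proof (intro conjI allI impI)
  note measurable_path_sup[OF assms, measurable]
  have [measurable]: "N \<in> borel_measurable borel"
    by (rule borel_measurable_continuous_onI[OF is_norm_continuous[OF assms]])
  show "Measurable.pred borel (\<lambda>y. is_infargmax N y 0)" 
    unfolding is_infargmax_def not_less[symmetric] by measurable
  fix y assume y: "vanishing_path N y" "N (y 0) > 1"
  then obtain k where k: "is_infargmax N y k" using vanishing_infargmax_exists by blast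
  have "ennreal (N (y 0)) \<le> ennreal (N (y k))"
    using path_sup_upper[of 0 UNIV N y] path_sup_UNIV_infargmax[OF k] by simp
  then have "N (y k) > 1" using y(2) is_norm_nonneg[OF assms] by (simp add: ennreal_le_iff)
  with k show "\<exists>!k. N (y k) > 1 \<and> is_infargmax N (shift_path k y) 0"
    unfolding is_infargmax_shift_path using is_infargmax_unique by blast
qed

section \<open>The law of the normalized cluster\<close>

lemma tail_process_exceeds_1:
  fixes N :: "'a::euclidean_space \<Rightarrow> real"
  assumes N: "is_norm N" and P: "prob_space P" and Y: "Y \<in> borel_measurable P"
    and tp: "tail_process N \<alpha> M X P Y"
  shows "AE \<omega> in P. N (Y \<omega> 0) > 1"
proof -
  interpret prob_space P by fact
  have [measurable]: "N \<in> borel_measurable borel"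
    by (rule borel_measurable_continuous_onI[OF is_norm_continuous[OF N]])
  note measurable_path_coordinate[OF Y, measurable]
  have "measure P {\<omega> \<in> space P. N (Y \<omega> 0) > 1} = 1"
    using tp by (auto simp: tail_process_def dest: spec[of _ "1::real"])
  moreover have "{\<omega> \<in> space P. N (Y \<omega> 0) > 1} \<in> sets P" by measurable
  ultimately have "AE \<omega> in P. \<omega> \<in> {\<omega> \<in> space P. N (Y \<omega> 0) > 1}"
    by (simp only: prob_eq_1)
  then show ?thesis by auto
qed

lemma path_sup_scale:
  assumes "is_norm N" "c \<ge> 0"
  shows "path_sup N A (\<lambda>j. c *\<^sub>R y j) = ennreal c * path_sup N A y"
  using assms(2) is_norm_nonneg[OF assms(1)]
  by (simp add: path_sup_def is_norm_scale[OF assms(1)] ennreal_mult SUP_mult_left_ennreal)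

lemma is_infargmax_scale:
  assumes N: "is_norm N" and c: "c > 0"
  shows "is_infargmax N (\<lambda>j. c *\<^sub>R y j) k \<longleftrightarrow> is_infargmax N y k"
proof -
  have "N (c *\<^sub>R y k) = c * N (y k)" using c by (simp add: is_norm_scale[OF N])
  then have "ennreal (N (c *\<^sub>R y k)) = ennreal c * ennreal (N (y k))"
    using c is_norm_nonneg[OF N] by (simp add: ennreal_mult)
  moreover have "ennreal c * a \<le> ennreal c * b \<longleftrightarrow> a \<le> b" for a b
    using c by (intro ennreal_mult_le_mult_iff) auto
  ultimately show ?thesis
    unfolding is_infargmax_def path_sup_scale[OF N less_imp_le[OF c]] not_le[symmetric] by simp
qed

text \<open>The conversion to the reals is that of the law of Q, so that both agree on every path.\<close>

definition normalized_path :: "('a::real_vector \<Rightarrow> real) \<Rightarrow> (int \<Rightarrow> 'a) \<Rightarrow> int \<Rightarrow> 'a" where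
  "normalized_path N y = (\<lambda>j. y j /\<^sub>R enn2real (path_sup N UNIV y))"

lemma measurable_normalized_path:
  fixes N :: "'a::euclidean_space \<Rightarrow> real"
  assumes "is_norm N"
  shows "normalized_path N \<in> borel_measurable borel"
proof -
  note measurable_path_sup[OF assms, measurable]
  show ?thesis
    unfolding normalized_path_def by (rule measurable_coordinatewise_then_product) measurable
qed

lemma normalized_path_backshift:
  "normalized_path N (backshift y) = backshift (normalized_path N y)"
proof -
  have "backshift y = shift_path (-1) y" by (simp add: backshift_def shift_path_def)
  then have "path_sup N UNIV (backshift y) = path_sup N UNIV y"
    by (simp add: path_sup_shift_path surj_plus_right)
  then show ?thesis by (simp add: normalized_path_def backshift_def)
qed

theorem proposition3p6:
  fixes N :: "real ^ 'd \<Rightarrow> real" and \<alpha> :: real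
    and M :: "'w measure" and X :: "'w \<Rightarrow> int \<Rightarrow> real ^ 'd"
    and P :: "'v measure" and Y :: "'v \<Rightarrow> int \<Rightarrow> real ^ 'd"
    and R :: "'q measure" and Q :: "'q \<Rightarrow> int \<Rightarrow> real ^ 'd"
    and H :: "(int \<Rightarrow> real ^ 'd) \<Rightarrow> ennreal"
  assumes "is_norm N"
    and "prob_space M" and "X \<in> borel_measurable M"
    and "stationary M X" and "regularly_varying N M X"
    and "\<alpha> > 0" and "tail_index N M X \<alpha>"
    and "prob_space P" and "Y \<in> borel_measurable P"
    and "tail_process N \<alpha> M X P Y"
    and "AE \<omega> in P. ((\<lambda>k. N (Y \<omega> k)) \<longlongrightarrow> 0) (filtercomap abs at_top)"
    and "prob_space R" and "Q \<in> borel_measurable R"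
    and "Q_process N P Y R Q"
    and "H \<in> borel_measurable borel" and "shift_invariant H"
  shows "ennreal (candidate_extremal_index N P Y) * (\<integral>\<^sup>+ \<omega>. H (Q \<omega>) \<partial>R) =
    (\<integral>\<^sup>+ \<omega>. H (spectral_tail_process N Y \<omega>) *
       indicator {\<omega> \<in> space P. infargmax N (spectral_tail_process N Y \<omega>) = Fin 0} \<omega> \<partial>P)"
proof -
  interpret P: prob_space P by fact
  interpret R: prob_space R by fact
  note N = assms(1) and Y = assms(9) and Q = assms(13) and H = assms(15)
  have Y0: "AE \<omega> in P. vanishing_path N (Y \<omega>)"
    using assms(11) by (simp add: vanishing_path_def)
  have Y1: "AE \<omega> in P. N (Y \<omega> 0) > 1" using tail_process_exceeds_1 assms by blast
  note exchange = exceedance_anchor_exchange[OF N assms(3,8,9,4,10) Y0 Y1]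
  note [measurable] = measurable_path_sup[OF N] measurable_normalized_path[OF N] Y Q H
  define E where "E = {\<omega> \<in> space P. path_sup N {..-1} (Y \<omega>) \<le> 1}"
  have E[measurable]: "E \<in> sets P" unfolding E_def by measurable
  define G where "G y = H (normalized_path N y)" for y
  have G: "G \<in> borel_measurable borel" unfolding G_def by measurable
  have Ginv: "shift_invariant G"
    using assms(16) by (simp add: shift_invariant_def G_def normalized_path_backshift)
  have Z[measurable]: "(\<lambda>\<omega>. normalized_path N (Y \<omega>)) \<in> borel_measurable P" by measurable
  have lawQ: "distr R borel Q = distr (uniform_measure P E) borel (\<lambda>\<omega>. normalized_path N (Y \<omega>))"
    using assms(14) by (simp add: Q_process_def E_def normalized_path_def)
  have intQ: "(\<integral>\<^sup>+\<omega>. h (Q \<omega>) \<partial>R) =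
      (\<integral>\<^sup>+\<omega>. h (normalized_path N (Y \<omega>)) * indicator E \<omega> \<partial>P) / emeasure P E"
    if [measurable]: "h \<in> borel_measurable borel" for h :: "(int \<Rightarrow> real ^ 'd) \<Rightarrow> ennreal"
  proof -
    have "(\<integral>\<^sup>+\<omega>. h (Q \<omega>) \<partial>R) = (\<integral>\<^sup>+y. h y \<partial>distr R borel Q)"
      by (rule nn_integral_distr[symmetric]) auto
    also have "\<dots> = (\<integral>\<^sup>+\<omega>. h (normalized_path N (Y \<omega>)) \<partial>uniform_measure P E)"
      unfolding lawQ by (rule nn_integral_distr) auto
    also have "\<dots> = (\<integral>\<^sup>+\<omega>. h (normalized_path N (Y \<omega>)) * indicator E \<omega> \<partial>P) / emeasure P E"
      by (rule nn_integral_uniform_measure) auto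
    finally show ?thesis .
  qed
  \<comment> \<open>If E were null, the conditional law would be the zero measure and not that of Q.\<close>
  have E_pos: "emeasure P E \<noteq> 0"
  proof
    assume "emeasure P E = 0"
    then have "(\<integral>\<^sup>+\<omega>. indicator E \<omega> \<partial>P) = 0" by simp
    then have "(\<integral>\<^sup>+\<omega>. 1 \<partial>R) = 0" using intQ[of "\<lambda>_. 1"] by simp
    then show False by (simp add: R.emeasure_space_1)
  qed
  have ind_E: "indicator E \<omega> = (indicator {y. path_sup N {..-1} y \<le> 1} (Y \<omega>) :: ennreal)"
    if "\<omega> \<in> space P" for \<omega>
    using that by (auto simp: E_def indicator_def)
  have \<theta>: "ennreal (candidate_extremal_index N P Y) = emeasure P E"
  proof -
    have "ennreal (candidate_extremal_index N P Y) =
        emeasure P {\<omega> \<in> space P. path_sup N {1..} (Y \<omega>) \<le> 1}"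
      by (simp add: candidate_extremal_index_def P.emeasure_eq_measure)
    also have "\<dots> = (\<integral>\<^sup>+\<omega>. indicator {\<omega> \<in> space P. path_sup N {1..} (Y \<omega>) \<le> 1} \<omega> \<partial>P)"
      by (rule nn_integral_indicator[symmetric]) measurable
    also have "\<dots> = (\<integral>\<^sup>+\<omega>. 1 * indicator {y. path_sup N {1..} y \<le> 1} (Y \<omega>) \<partial>P)"
      by (rule nn_integral_cong) (auto simp: indicator_def)
    also have "\<dots> = (\<integral>\<^sup>+\<omega>. 1 * indicator {y. path_sup N {..-1} y \<le> 1} (Y \<omega>) \<partial>P)"
      by (rule exchange[OF _ _ last_exceedance_anchor[OF N] first_exceedance_anchor[OF N]])
        (auto simp: shift_invariant_def)
    also have "\<dots> = (\<integral>\<^sup>+\<omega>. indicator E \<omega> \<partial>P)"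
      by (rule nn_integral_cong) (simp add: ind_E)
    finally show ?thesis by simp
  qed
  have "ennreal (candidate_extremal_index N P Y) * (\<integral>\<^sup>+ \<omega>. H (Q \<omega>) \<partial>R) =
      (\<integral>\<^sup>+\<omega>. G (Y \<omega>) * indicator E \<omega> \<partial>P)"
    unfolding \<theta> intQ[OF H] G_def using E_pos
    by (simp add: ennreal_times_divide mult_divide_eq_ennreal mult.commute[of "emeasure P E"])
  also have "\<dots> = (\<integral>\<^sup>+\<omega>. G (Y \<omega>) * indicator {y. path_sup N {..-1} y \<le> 1} (Y \<omega>) \<partial>P)"
    by (rule nn_integral_cong) (simp add: ind_E)
  also have "\<dots> = (\<integral>\<^sup>+\<omega>. G (Y \<omega>) * indicator {y. is_infargmax N y 0} (Y \<omega>) \<partial>P)"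
    by (rule exchange[OF G Ginv first_exceedance_anchor[OF N] infargmax_anchor[OF N]])
  also have "\<dots> = (\<integral>\<^sup>+ \<omega>. H (spectral_tail_process N Y \<omega>) *
       indicator {\<omega> \<in> space P. infargmax N (spectral_tail_process N Y \<omega>) = Fin 0} \<omega> \<partial>P)"
  proof (rule nn_integral_cong_AE, use Y1 AE_space in eventually_elim)
    case (elim \<omega>)
    have \<Theta>: "spectral_tail_process N Y \<omega> = (\<lambda>j. inverse (N (Y \<omega> 0)) *\<^sub>R Y \<omega> j)"
      by (simp add: spectral_tail_process_def fun_eq_iff)
    have iff: "infargmax N (spectral_tail_process N Y \<omega>) = Fin 0 \<longleftrightarrow> is_infargmax N (Y \<omega>) 0"
      unfolding infargmax_eq_Fin_iff \<Theta> using elim(1) by (intro is_infargmax_scale[OF N]) simp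
    have "normalized_path N (Y \<omega>) = spectral_tail_process N Y \<omega>" if "is_infargmax N (Y \<omega>) 0"
      using path_sup_UNIV_infargmax[OF that] is_norm_nonneg[OF N]
      by (simp add: normalized_path_def \<Theta>)
    then show ?case using elim(2) by (auto simp: G_def iff indicator_def)
  qed
  finally show ?thesis .
qed

end
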